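(* Fix $p\in(0,1)$. For $n\ge1$ let $\mathbb S_n$ be the set of permutations of $\{1,\dots,n\}$, and let $p^\uparrow_n$ (from $\mathbb S_n$ to $\mathbb S_{n+1}$) and $p^\downarrow_{n+1}$ (from $\mathbb S_{n+1}$ to $\mathbb S_n$) be the up- and down-step transition matrices on permutations defined in the context. Then $$p^\uparrow_np^\downarrow_{n+1}=\frac{n-1}{n+1}\,p^\downarrow_np^\uparrow_{n-1}+\frac{2}{n+1}\,\delta_n,\qquad n\ge2,$$ where $\delta_n$ is the identity kernel on $\mathbb S_n$. Consequently, with $c_n=n(n+1)$, $T_n$ the transition operator on $C(\mathbb S_n)$ of $p^\uparrow_np^\downarrow_{n+1}$, $D_{n+1}:C(\mathbb S_n)\to C(\mathbb S_{n+1})$ the transition operator of $p^\downarrow_{n+1}$, and $A_n=c_n(T_n-I)$, the following hold for every $n\ge1$: $0<c_n<c_{n+1}$; $D_{n+1}$ is a transition operator from $C(\mathbb S_n)$ to $C(\mathbb S_{n+1})$; $\operatorname{range}(A_{n+1}+c_nI)\subset\operatorname{range}D_{n+1}$; $D_{n+1}$ is injective; and $A_{n+1}D_{n+1}=D_{n+1}A_n$.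
   Context: The diagram of $\sigma\in\mathbb S_n$ is $\{(i,\sigma(i)):1\le i\le n\}$. $p^\uparrow_n(\sigma,\rho)$ is the probability that $\rho$ is obtained from $\sigma$ by picking a uniformly random point of the diagram and replacing it by two new points that are consecutive both in position and in value (shifting the other points so as to obtain a permutation of size $n+1$), the two new points being in increasing position with probability $p$ and in decreasing position with probability $1-p$. $p^\downarrow_{n+1}(\rho,\sigma)$ is the probability that deleting a uniformly random point of the diagram of $\rho$ and relabelling positions and values order-preservingly gives $\sigma$. The transition operator of a stochastic matrix $\mu$ is $f\mapsto\sum_y\mu(\cdot,y)f(y)$. $C(\mathbb S_n)$ is the space of real functions on $\mathbb S_n$. *)

theory Defs
  imports "HOL-Probability.Probability" "HOL-Combinatorics.Permutations"
begin

definition perms :: "nat \<Rightarrow> (nat \<Rightarrow> nat) set" where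
  "perms n = {\<sigma>. \<sigma> permutes {1..n}}"

definition diagram :: "nat \<Rightarrow> (nat \<Rightarrow> nat) \<Rightarrow> (nat \<times> nat) set" where
  "diagram n \<sigma> = (\<lambda>i. (i, \<sigma> i)) ` {1..n}"

text \<open>A step acts on the diagram as a set of points; since a permutation is determined by its
  diagram, the outcome of a step is the permutation \<open>\<rho>\<close> iff the resulting point set is the
  diagram of \<open>\<rho>\<close>.\<close>

definition shift_up :: "nat \<Rightarrow> nat \<Rightarrow> nat" where
  "shift_up a x = (if a < x then x + 1 else x)"

definition shift_down :: "nat \<Rightarrow> nat \<Rightarrow> nat" where
  "shift_down a x = (if a < x then x - 1 else x)"

definition duplicate_point ::
    "(nat \<times> nat) set \<Rightarrow> nat \<times> nat \<Rightarrow> bool \<Rightarrow> (nat \<times> nat) set" where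
  "duplicate_point P = (\<lambda>(i, v) increasing.
     map_prod (shift_up i) (shift_up v) ` (P - {(i, v)})
       \<union> (if increasing then {(i, v), (i + 1, v + 1)} else {(i, v + 1), (i + 1, v)}))"

definition delete_point :: "(nat \<times> nat) set \<Rightarrow> nat \<times> nat \<Rightarrow> (nat \<times> nat) set" where
  "delete_point P = (\<lambda>(i, v). map_prod (shift_down i) (shift_down v) ` (P - {(i, v)}))"

definition p_up :: "real \<Rightarrow> nat \<Rightarrow> (nat \<Rightarrow> nat) \<Rightarrow> (nat \<Rightarrow> nat) \<Rightarrow> real" where
  "p_up p n \<sigma> \<rho> =
     measure_pmf.prob (pair_pmf (pmf_of_set (diagram n \<sigma>)) (bernoulli_pmf p))
       {(pt, b). duplicate_point (diagram n \<sigma>) pt b = diagram (n + 1) \<rho>}"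

text \<open>The index of the down-step is the size of the source: \<open>p_down n\<close> goes from
  \<open>perms n\<close> to \<open>perms (n - 1)\<close> and is meaningful for \<open>n \<ge> 1\<close>.\<close>

definition p_down :: "nat \<Rightarrow> (nat \<Rightarrow> nat) \<Rightarrow> (nat \<Rightarrow> nat) \<Rightarrow> real" where
  "p_down n \<rho> \<sigma> =
     measure_pmf.prob (pmf_of_set (diagram n \<rho>))
       {pt. delete_point (diagram n \<rho>) pt = diagram (n - 1) \<sigma>}"

definition kernel_comp ::
    "'b set \<Rightarrow> ('a \<Rightarrow> 'b \<Rightarrow> real) \<Rightarrow> ('b \<Rightarrow> 'c \<Rightarrow> real) \<Rightarrow> 'a \<Rightarrow> 'c \<Rightarrow> real" where
  "kernel_comp Y \<mu> \<nu> x z = (\<Sum>y\<in>Y. \<mu> x y * \<nu> y z)"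

definition id_kernel :: "'a \<Rightarrow> 'a \<Rightarrow> real" where
  "id_kernel x y = (if x = y then 1 else 0)"

definition stochastic_matrix :: "'a set \<Rightarrow> 'b set \<Rightarrow> ('a \<Rightarrow> 'b \<Rightarrow> real) \<Rightarrow> bool" where
  "stochastic_matrix X Y \<mu> \<longleftrightarrow>
     (\<forall>x\<in>X. (\<forall>y\<in>Y. 0 \<le> \<mu> x y) \<and> (\<Sum>y\<in>Y. \<mu> x y) = 1)"

text \<open>Real functions on \<open>X\<close> are represented by extensional functions, so that equality of
  functions on \<open>X\<close> is equality in HOL.\<close>

definition C :: "'a set \<Rightarrow> ('a \<Rightarrow> real) set" where
  "C X = (X \<rightarrow>\<^sub>E UNIV)"

definition transition_op ::
    "'a set \<Rightarrow> 'b set \<Rightarrow> ('a \<Rightarrow> 'b \<Rightarrow> real) \<Rightarrow> ('b \<Rightarrow> real) \<Rightarrow> ('a \<Rightarrow> real)" where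
  "transition_op X Y \<mu> f = (\<lambda>x\<in>X. \<Sum>y\<in>Y. \<mu> x y * f y)"

text \<open>Note the direction: a matrix from \<open>X\<close> to \<open>Y\<close> acts from \<open>C Y\<close> to \<open>C X\<close>.\<close>

definition is_transition_op ::
    "'b set \<Rightarrow> 'a set \<Rightarrow> (('b \<Rightarrow> real) \<Rightarrow> ('a \<Rightarrow> real)) \<Rightarrow> bool" where
  "is_transition_op Y X L \<longleftrightarrow>
     (\<exists>\<mu>. stochastic_matrix X Y \<mu> \<and> (\<forall>f\<in>C Y. L f = transition_op X Y \<mu> f))"

definition c :: "nat \<Rightarrow> real" where
  "c n = real n * (real n + 1)"

definition T :: "real \<Rightarrow> nat \<Rightarrow> ((nat \<Rightarrow> nat) \<Rightarrow> real) \<Rightarrow> ((nat \<Rightarrow> nat) \<Rightarrow> real)" where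
  "T p n = transition_op (perms n) (perms n)
             (kernel_comp (perms (n + 1)) (p_up p n) (p_down (n + 1)))"

definition D :: "nat \<Rightarrow> ((nat \<Rightarrow> nat) \<Rightarrow> real) \<Rightarrow> ((nat \<Rightarrow> nat) \<Rightarrow> real)" where
  "D n = transition_op (perms n) (perms (n - 1)) (p_down n)"

definition A :: "real \<Rightarrow> nat \<Rightarrow> ((nat \<Rightarrow> nat) \<Rightarrow> real) \<Rightarrow> ((nat \<Rightarrow> nat) \<Rightarrow> real)" where
  "A p n f = (\<lambda>\<sigma>\<in>perms n. c n * (T p n f \<sigma> - f \<sigma>))"

end

theory Submission
  imports Defs
begin

text \<open>Delete, after duplicating a point \<open>x\<close> of \<open>\<sigma>\<close>, a uniform point of the result. With probability
  \<open>2 / (n + 1)\<close> one of the two copies of \<open>x\<close> is removed, which restores \<open>\<sigma>\<close>. Otherwise the removed point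
  comes from some \<open>q \<noteq> x\<close> of \<open>\<sigma>\<close>, and deleting \<open>q\<close> commutes with duplicating \<open>x\<close>; all ordered pairs
  \<open>(x, q)\<close> of distinct points are equally likely in both orders of operations. This is the kernel identity.

  Let \<open>U\<^sub>n\<close> be the transition operator of the up-step. The identity reads
  \<open>A\<^sub>n\<^sub>+\<^sub>1 = c\<^sub>n (D\<^sub>n\<^sub>+\<^sub>1 U\<^sub>n - I)\<close>, while \<open>A\<^sub>n = c\<^sub>n (U\<^sub>n D\<^sub>n\<^sub>+\<^sub>1 - I)\<close>, whence the range inclusion and the intertwining.
  Since \<open>DU\<close> and \<open>UD\<close> have the same nonzero eigenvalues, induction on \<open>n\<close> shows that all real eigenvalues of
  \<open>T\<^sub>n = U\<^sub>n D\<^sub>n\<^sub>+\<^sub>1\<close> are positive, so \<open>D\<^sub>n\<^sub>+\<^sub>1\<close> is injective.\<close>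

section \<open>Diagrams\<close>

text \<open>The diagrams of permutations, described intrinsically (\<open>bij_betw_diagram\<close>):
  the outcome of a step can be handled as a point set, without constructing its permutation.\<close>

definition diagrams :: "nat \<Rightarrow> (nat \<times> nat) set set" where
  "diagrams n = {P. bij_betw fst P {1..n} \<and> bij_betw snd P {1..n}}"

lemma diagrams_finite: "P \<in> diagrams n \<Longrightarrow> finite P"
  using bij_betw_finite[of fst P "{1..n}"] by (auto simp: diagrams_def)

lemma diagrams_card: "P \<in> diagrams n \<Longrightarrow> card P = n"
  using bij_betw_same_card[of fst P "{1..n}"] by (auto simp: diagrams_def)

lemma diagrams_fst_eq_iff: "\<lbrakk>P \<in> diagrams n; x \<in> P; y \<in> P\<rbrakk> \<Longrightarrow> fst x = fst y \<longleftrightarrow> x = y"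
  by (auto simp: diagrams_def bij_betw_def dest: inj_onD)

lemma diagrams_snd_eq_iff: "\<lbrakk>P \<in> diagrams n; x \<in> P; y \<in> P\<rbrakk> \<Longrightarrow> snd x = snd y \<longleftrightarrow> x = y"
  by (auto simp: diagrams_def bij_betw_def dest: inj_onD)

lemma diagrams_range: "\<lbrakk>P \<in> diagrams n; (i, v) \<in> P\<rbrakk> \<Longrightarrow> i \<in> {1..n} \<and> v \<in> {1..n}"
  using bij_betwE[of fst P "{1..n}"] bij_betwE[of snd P "{1..n}"]
  by (fastforce simp: diagrams_def)

lemma diagram_inj: "inj_on (diagram n) (perms n)"
proof (rule inj_onI, rule ext)
  fix \<sigma> \<tau> x
  assume "\<sigma> \<in> perms n" "\<tau> \<in> perms n" and eq: "diagram n \<sigma> = diagram n \<tau>"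
  then have *: "\<sigma> permutes {1..n}" "\<tau> permutes {1..n}" by (auto simp: perms_def)
  show "\<sigma> x = \<tau> x"
  proof (cases "x \<in> {1..n}")
    case True
    then have "(x, \<sigma> x) \<in> diagram n \<tau>" unfolding eq[symmetric] by (auto simp: diagram_def)
    then show ?thesis by (auto simp: diagram_def)
  next
    case False
    then show ?thesis using * by (metis permutes_not_in)
  qed
qed

lemma diagram_in_diagrams:
  assumes "\<sigma> \<in> perms n"
  shows "diagram n \<sigma> \<in> diagrams n"
proof -
  have \<sigma>: "inj_on \<sigma> {1..n}" "\<sigma> ` {1..n} = {1..n}"
    using assms by (auto simp: perms_def permutes_image dest: permutes_inj_on)
  have "inj_on fst (diagram n \<sigma>)" by (auto simp: diagram_def inj_on_def)
  moreover have "inj_on snd (diagram n \<sigma>)"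
    unfolding diagram_def by (rule inj_on_imageI) (use \<sigma>(1) in \<open>simp add: comp_def\<close>)
  moreover have "fst ` diagram n \<sigma> = {1..n}" "snd ` diagram n \<sigma> = {1..n}"
    unfolding diagram_def image_image fst_conv snd_conv \<sigma>(2) by simp_all
  ultimately show ?thesis by (simp add: diagrams_def bij_betw_def)
qed

lemma diagrams_subset_image: "diagrams n \<subseteq> diagram n ` perms n"
proof
  fix P assume P: "P \<in> diagrams n"
  then have f: "bij_betw fst P {1..n}" and s: "bij_betw snd P {1..n}"
    by (auto simp: diagrams_def)
  \<comment> \<open>The permutation is read off \<open>P\<close>: \<open>h\<close> lifts a position
    to the point above it, and the second coordinate of that point is the value.\<close>
  define h where "h = the_inv_into P fst"
  have h: "bij_betw h {1..n} P"
    using f bij_betw_the_inv_into h_def by blast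
  have fh: "fst (h i) = i" if "i \<in> {1..n}" for i
    using that f f_the_inv_into_f_bij_betw h_def by metis
  define \<sigma> where "\<sigma> i = (if i \<in> {1..n} then snd (h i) else i)" for i
  have "bij_betw (snd \<circ> h) {1..n} {1..n}" using h s by (rule bij_betw_trans)
  then have "bij_betw \<sigma> {1..n} {1..n}"
    by (rule bij_betw_cong[THEN iffD1, rotated]) (simp add: \<sigma>_def)
  then have "\<sigma> permutes {1..n}"
    by (rule bij_imp_permutes) (auto simp: \<sigma>_def)
  moreover have "diagram n \<sigma> = P"
  proof -
    have "diagram n \<sigma> = h ` {1..n}"
      unfolding diagram_def
    proof (rule image_cong[OF refl])
      fix i assume "i \<in> {1..n}"
      then show "(i, \<sigma> i) = h i" using fh[of i] by (simp add: \<sigma>_def prod_eq_iff)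
    qed
    then show ?thesis using h by (simp add: bij_betw_def)
  qed
  ultimately show "P \<in> diagram n ` perms n" by (force simp: perms_def)
qed

lemma bij_betw_diagram: "bij_betw (diagram n) (perms n) (diagrams n)"
  unfolding bij_betw_def using diagram_inj diagram_in_diagrams diagrams_subset_image by blast

lemma finite_perms: "finite (perms n)"
  by (simp add: perms_def finite_permutations)

text \<open>Exactly one \<open>\<rho>\<close> has diagram \<open>P\<close>. This collapses the sum
  over the intermediate permutation in a composed kernel, and the row sums in
  \<open>stochastic_p_down\<close>.\<close>

lemma sum_perms_diagram:
  assumes "P \<in> diagrams n"
  shows "(\<Sum>\<rho>\<in>perms n. of_bool (P = diagram n \<rho>) * F (diagram n \<rho>)) = (F P :: real)"
proof -
  have "finite (diagrams n)"
    using bij_betw_finite[OF bij_betw_diagram[of n]] finite_perms[of n] by simp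
  moreover have "(\<Sum>\<rho>\<in>perms n. of_bool (P = diagram n \<rho>) * F (diagram n \<rho>)) =
      (\<Sum>Q\<in>diagrams n. of_bool (P = Q) * F Q)"
    by (rule sum.reindex_bij_betw[OF bij_betw_diagram])
  moreover have "of_bool (P = Q) * F Q = (if P = Q then F Q else 0)" for Q
    by simp
  ultimately show ?thesis using assms by simp
qed

section \<open>Duplication and deletion of points\<close>

lemma bij_betw_shift_up:
  "i \<in> {1..n} \<Longrightarrow> bij_betw (shift_up i) ({1..n} - {i}) ({1..n + 1} - {i, i + 1})"
  by (rule bij_betw_byWitness[where f' = "shift_down i"]) (auto simp: shift_up_def shift_down_def)

lemma bij_betw_shift_down:
  "i \<in> {1..n + 1} \<Longrightarrow> bij_betw (shift_down i) ({1..n + 1} - {i}) {1..n}"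
  \<comment> \<open>The inverse differs from \<open>shift_up i\<close> at \<open>i\<close> itself:
    deletion closes the gap, so \<open>i\<close> must go back to \<open>i + 1\<close>.\<close>
  by (rule bij_betw_byWitness[where f' = "\<lambda>x. if x < i then x else x + 1"])
    (auto simp: shift_down_def)

lemma bij_betw_fst_map_prod:
  "\<lbrakk>bij_betw fst R X; bij_betw f X Y\<rbrakk> \<Longrightarrow> bij_betw fst (map_prod f g ` R) Y"
  unfolding bij_betw_def image_image
  by (rule conjI, rule inj_on_imageI, subst fst_comp_map_prod, rule comp_inj_on) auto

lemma bij_betw_snd_map_prod:
  "\<lbrakk>bij_betw snd R X; bij_betw g X Y\<rbrakk> \<Longrightarrow> bij_betw snd (map_prod f g ` R) Y"
  unfolding bij_betw_def image_image
  by (rule conjI, rule inj_on_imageI, subst snd_comp_map_prod, rule comp_inj_on) auto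

lemma diagrams_remove:
  assumes "P \<in> diagrams n" "(i, v) \<in> P"
  shows "bij_betw fst (P - {(i, v)}) ({1..n} - {i})" "bij_betw snd (P - {(i, v)}) ({1..n} - {v})"
proof -
  have "bij_betw fst P {1..n}" "bij_betw snd P {1..n}" "{(i, v)} \<subseteq> P" "{i} \<subseteq> {1..n}" "{v} \<subseteq> {1..n}"
    using assms diagrams_range[OF assms] by (auto simp: diagrams_def)
  moreover have "bij_betw fst {(i, v)} {i}" "bij_betw snd {(i, v)} {v}" by auto
  ultimately show "bij_betw fst (P - {(i, v)}) ({1..n} - {i})"
    "bij_betw snd (P - {(i, v)}) ({1..n} - {v})"
    by (blast intro: bij_betw_DiffI)+
qed

lemma delete_point_diagrams:
  assumes "P \<in> diagrams (n + 1)" "x \<in> P"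
  shows "delete_point P x \<in> diagrams n"
proof -
  obtain i v where x: "x = (i, v)" by fastforce
  note P = assms[unfolded x]
  have iv: "i \<in> {1..n + 1}" "v \<in> {1..n + 1}" using diagrams_range[OF P] by auto
  show ?thesis
    unfolding diagrams_def delete_point_def x prod.case mem_Collect_eq
    by (intro conjI bij_betw_fst_map_prod[OF diagrams_remove(1)[OF P] bij_betw_shift_down[OF iv(1)]]
        bij_betw_snd_map_prod[OF diagrams_remove(2)[OF P] bij_betw_shift_down[OF iv(2)]])
qed

lemma duplicate_point_diagrams:
  assumes "P \<in> diagrams n" "x \<in> P"
  shows "duplicate_point P x b \<in> diagrams (n + 1)"
proof -
  obtain i v where x: "x = (i, v)" by fastforce
  have iv: "i \<in> {1..n}" "v \<in> {1..n}" using diagrams_range assms x by auto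
  define R where "R = map_prod (shift_up i) (shift_up v) ` (P - {(i, v)})"
  define N where "N = (if b then {(i, v), (i + 1, v + 1)} else {(i, v + 1), (i + 1, v)})"
  have "bij_betw fst (R \<union> N) (({1..n + 1} - {i, i + 1}) \<union> {i, i + 1})"
  proof (rule bij_betw_combine)
    show "bij_betw fst R ({1..n + 1} - {i, i + 1})"
      unfolding R_def using assms[unfolded x]
      by (intro bij_betw_fst_map_prod[OF diagrams_remove(1) bij_betw_shift_up] iv)
  qed (auto simp: N_def bij_betw_def)
  moreover have "bij_betw snd (R \<union> N) (({1..n + 1} - {v, v + 1}) \<union> {v, v + 1})"
  proof (rule bij_betw_combine)
    show "bij_betw snd R ({1..n + 1} - {v, v + 1})"
      unfolding R_def using assms[unfolded x]
      by (intro bij_betw_snd_map_prod[OF diagrams_remove(2) bij_betw_shift_up] iv)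
  qed (auto simp: N_def bij_betw_def)
  moreover have "({1..n + 1} - {j, j + 1}) \<union> {j, j + 1} = {1..n + 1}" if "j \<in> {1..n}" for j
    using that by auto
  moreover have "duplicate_point P x b = R \<union> N"
    by (simp add: duplicate_point_def R_def N_def x)
  ultimately show ?thesis using iv by (simp add: diagrams_def)
qed

text \<open>Both \<open>i\<close> and \<open>Suc i\<close> are coordinates of the copies, so a
  deletion at either one has to undo the shift made for duplicating at \<open>i\<close>.\<close>

lemma shift_down_shift_up [simp]:
  "x \<noteq> i \<Longrightarrow> shift_down i (shift_up i x) = x"
  "x \<noteq> i \<Longrightarrow> shift_down (Suc i) (shift_up i x) = x"
  by (auto simp: shift_up_def shift_down_def)

lemma shift_up_neq [simp]: "x \<noteq> i \<Longrightarrow> shift_up i x \<noteq> i" "shift_up i x \<noteq> Suc i"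
  by (auto simp: shift_up_def)

lemma shift_down_self [simp]:
  "shift_down i i = i" "shift_down (Suc i) i = i" "shift_down i (Suc i) = i"
  by (auto simp: shift_down_def)

text \<open>One coordinate of the commutation of duplicating at \<open>i\<close> with deleting at
  \<open>j\<close>: each operation acts where the other one has moved its base coordinate. The two
  copies are treated in \<open>shift_down_shift_up_copy\<close>.\<close>

lemma shift_down_shift_up_commute:
  assumes "i \<noteq> j" "x \<noteq> i" "x \<noteq> j"
  shows "shift_down (shift_up i j) (shift_up i x) = shift_up (shift_down j i) (shift_down j x)"
  using assms by (auto simp: shift_up_def shift_down_def)

lemma shift_down_shift_up_copy:
  assumes "i \<noteq> j"
  shows "shift_down (shift_up i j) i = shift_down j i"
    and "shift_down (shift_up i j) (Suc i) = Suc (shift_down j i)"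
  using assms by (auto simp: shift_up_def shift_down_def)

lemma shift_up_inj: "shift_up i x = shift_up i y \<longleftrightarrow> x = y"
  by (auto simp: shift_up_def)

lemma shift_down_inj: "\<lbrakk>x \<noteq> i; y \<noteq> i\<rbrakk> \<Longrightarrow> shift_down i x = shift_down i y \<longleftrightarrow> x = y"
  by (auto simp: shift_down_def)

section \<open>Duplication and deletion acting on the points of a diagram\<close>

definition copies :: "nat \<times> nat \<Rightarrow> bool \<Rightarrow> (nat \<times> nat) set" where
  "copies = (\<lambda>(i, v) b. if b then {(i, v), (i + 1, v + 1)} else {(i, v + 1), (i + 1, v)})"

text \<open>The first argument is the point being duplicated; the second is another point, sent to
  its place in the new diagram. \<open>down_point\<close> does the same for deletion.\<close>

definition up_point :: "nat \<times> nat \<Rightarrow> nat \<times> nat \<Rightarrow> nat \<times> nat" where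
  "up_point = (\<lambda>(i, v). map_prod (shift_up i) (shift_up v))"

definition down_point :: "nat \<times> nat \<Rightarrow> nat \<times> nat \<Rightarrow> nat \<times> nat" where
  "down_point = (\<lambda>(i, v). map_prod (shift_down i) (shift_down v))"

lemma duplicate_point_eq: "duplicate_point P x b = up_point x ` (P - {x}) \<union> copies x b"
  by (cases x) (simp add: duplicate_point_def up_point_def copies_def)

lemma delete_point_eq: "delete_point P x = down_point x ` (P - {x})"
  by (cases x) (simp add: delete_point_def down_point_def)

lemma inj_up_point: "inj_on (up_point x) X"
  by (auto simp: inj_on_def up_point_def shift_up_inj split: prod.splits)

text \<open>Distinct points of a diagram have distinct positions, and \<open>shift_up\<close> then
  avoids both positions taken by the copies.\<close>

lemma up_point_notin_copies:
  "\<lbrakk>P \<in> diagrams n; x \<in> P; y \<in> P; x \<noteq> y\<rbrakk> \<Longrightarrow> up_point x y \<notin> copies x b"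
  using diagrams_fst_eq_iff[of P n x y]
  by (cases x; cases y) (auto simp: up_point_def copies_def split: if_splits)

text \<open>\<open>shift_down i\<close> merges \<open>i\<close> and \<open>i + 1\<close>;
  injectivity comes from the other points of a diagram avoiding the row and the column of
  \<open>q\<close>.\<close>

lemma inj_down_point:
  assumes P: "P \<in> diagrams n" "q \<in> P"
  shows "inj_on (down_point q) (P - {q})"
proof (rule inj_onI)
  fix x y assume xy: "x \<in> P - {q}" "y \<in> P - {q}" "down_point q x = down_point q y"
  then have "fst x \<noteq> fst q" "fst y \<noteq> fst q"
    using diagrams_fst_eq_iff P by blast+
  moreover have "snd x \<noteq> snd q" "snd y \<noteq> snd q"
    using xy diagrams_snd_eq_iff P by blast+
  ultimately show "x = y" using xy(3)
    by (cases q; cases x; cases y) (simp add: down_point_def shift_down_inj)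
qed

text \<open>The surviving copy moves back onto \<open>x\<close>, whichever copy is removed and in
  either orientation \<open>b\<close>; for every other point the two shifts cancel.\<close>

lemma delete_copy:
  assumes P: "P \<in> diagrams n" "x \<in> P" and y: "y \<in> copies x b"
  shows "delete_point (duplicate_point P x b) y = P"
proof -
  obtain i v where x: "x = (i, v)" by fastforce
  have neq: "fst z \<noteq> i \<and> snd z \<noteq> v" if "z \<in> P - {x}" for z
    using that P diagrams_fst_eq_iff[of P n z x] diagrams_snd_eq_iff[of P n z x] x by auto
  have "duplicate_point P x b - {y} = up_point x ` (P - {x}) \<union> (copies x b - {y})"
    using y up_point_notin_copies[OF P] by (fastforce simp: duplicate_point_eq)
  moreover have "down_point y ` (copies x b - {y}) = {x}"
    using y unfolding x
    by (cases b) (auto simp: copies_def down_point_def insert_Diff_if)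
  moreover have "down_point y ` up_point x ` (P - {x}) = P - {x}"
  proof -
    have "down_point y (up_point x z) = z" if "z \<in> P - {x}" for z
      using neq[OF that] y unfolding x
      by (cases z; cases b) (auto simp: copies_def down_point_def up_point_def)
    then show ?thesis by (force simp: image_image)
  qed
  ultimately show ?thesis using P by (auto simp: delete_point_eq image_Un)
qed

text \<open>After duplicating \<open>x\<close>, the point \<open>q\<close> sits at
  \<open>up_point x q\<close>; after deleting \<open>q\<close>, the point \<open>x\<close> sits at
  \<open>down_point q x\<close>. The copies and each remaining point are compared by the
  coordinatewise rules.\<close>

lemma delete_duplicate_commute:
  assumes P: "P \<in> diagrams n" "x \<in> P" "q \<in> P" and "x \<noteq> q"
  shows "delete_point (duplicate_point P x b) (up_point x q) =
    duplicate_point (delete_point P q) (down_point q x) b"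
proof -
  obtain i v where x: "x = (i, v)" by fastforce
  obtain j w where q: "q = (j, w)" by fastforce
  have ij: "i \<noteq> j" "v \<noteq> w"
    using P \<open>x \<noteq> q\<close> diagrams_fst_eq_iff[of P n x q] diagrams_snd_eq_iff[of P n x q] x q by auto
  have "down_point (up_point x q) ` copies x b = copies (down_point q x) b"
    using ij by (auto simp: x q down_point_def up_point_def copies_def shift_down_shift_up_copy)
  moreover have "(\<lambda>z. down_point (up_point x q) (up_point x z)) ` (P - {x, q}) =
    (\<lambda>z. up_point (down_point q x) (down_point q z)) ` (P - {x, q})"
  proof (rule image_cong[OF refl])
    fix z assume "z \<in> P - {x, q}"
    then show "down_point (up_point x q) (up_point x z) =
        up_point (down_point q x) (down_point q z)"
      using ij P diagrams_fst_eq_iff[of P n z x] diagrams_snd_eq_iff[of P n z x]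
        diagrams_fst_eq_iff[of P n z q] diagrams_snd_eq_iff[of P n z q]
      by (cases z) (simp add: x q down_point_def up_point_def shift_down_shift_up_commute)
  qed
  moreover have "duplicate_point P x b - {up_point x q} = up_point x ` (P - {x, q}) \<union> copies x b"
    using up_point_notin_copies[OF P \<open>x \<noteq> q\<close>] inj_up_point[of x UNIV]
    by (auto simp: duplicate_point_eq dest: injD)
  moreover have "delete_point P q - {down_point q x} = down_point q ` (P - {x, q})"
    using inj_down_point[OF P(1,3)] P \<open>x \<noteq> q\<close> by (auto simp: delete_point_eq dest: inj_onD)
  ultimately show ?thesis
    by (simp add: delete_point_eq[of "duplicate_point P x b"] duplicate_point_eq[of "delete_point P q"]
        image_Un image_image)
qed

text \<open>Each of the two copies restores \<open>P\<close> when deleted; the other points come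
  from some \<open>q\<close> in \<open>P - {x}\<close>, where deletion commutes with duplication.
  \<open>f\<close> will be the indicator of a target diagram.\<close>

lemma sum_duplicate_point:
  assumes P: "P \<in> diagrams n" "x \<in> P"
  shows "(\<Sum>q\<in>duplicate_point P x b. f (delete_point (duplicate_point P x b) q)) =
    2 * f P + (\<Sum>q\<in>P - {x}. f (duplicate_point (delete_point P q) (down_point q x) b) :: real)"
proof -
  let ?Q = "duplicate_point P x b"
  have card: "card (copies x b) = 2" "finite (copies x b)"
    by (auto simp: copies_def split: prod.splits)
  have "(\<Sum>q\<in>?Q. f (delete_point ?Q q)) =
      (\<Sum>q\<in>up_point x ` (P - {x}). f (delete_point ?Q q)) + (\<Sum>q\<in>copies x b. f (delete_point ?Q q))"
  proof -
    have "up_point x ` (P - {x}) \<inter> copies x b = {}"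
      using up_point_notin_copies[OF P] by blast
    then show ?thesis
      unfolding duplicate_point_eq[of P x b]
      by (intro sum.union_disjoint finite_imageI finite_Diff diagrams_finite[OF P(1)] card(2))
  qed
  also have "(\<Sum>q\<in>copies x b. f (delete_point ?Q q)) = 2 * f P"
    using delete_copy[OF P] card by simp
  also have "(\<Sum>q\<in>up_point x ` (P - {x}). f (delete_point ?Q q)) =
      (\<Sum>q\<in>P - {x}. f (delete_point ?Q (up_point x q)))"
    by (simp add: sum.reindex[OF inj_up_point])
  also have "\<dots> = (\<Sum>q\<in>P - {x}. f (duplicate_point (delete_point P q) (down_point q x) b))"
    by (rule sum.cong[OF refl]) (use delete_duplicate_commute[OF P] in auto)
  finally show ?thesis by simp
qed

section \<open>The kernel identity\<close>

lemma p_down_eq: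
  assumes "\<rho> \<in> perms n" "n \<ge> 1"
  shows "p_down n \<rho> \<sigma> =
    (\<Sum>q\<in>diagram n \<rho>. of_bool (delete_point (diagram n \<rho>) q = diagram (n - 1) \<sigma>)) / real n"
proof -
  let ?P = "diagram n \<rho>"
  have P: "?P \<in> diagrams n" using assms diagram_in_diagrams by blast
  have fin: "finite ?P" "?P \<noteq> {}" "card ?P = n"
    using diagrams_finite[OF P] diagrams_card[OF P] assms by auto
  show ?thesis
    unfolding p_down_def using fin
    by (simp add: measure_pmf_of_set sum.inter_filter[symmetric] of_bool_def Int_def)
qed

lemma p_up_eq:
  assumes "0 < p" "p < 1" "\<sigma> \<in> perms n" "n \<ge> 1"
  shows "p_up p n \<sigma> \<rho> = (\<Sum>x\<in>diagram n \<sigma>. \<Sum>b\<in>UNIV. (if b then p else 1 - p) *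
      of_bool (duplicate_point (diagram n \<sigma>) x b = diagram (n + 1) \<rho>)) / real n"
proof -
  let ?P = "diagram n \<sigma>"
  have P: "?P \<in> diagrams n" using assms diagram_in_diagrams by blast
  have fin: "finite ?P" "?P \<noteq> {}" "card ?P = n"
    using diagrams_finite[OF P] diagrams_card[OF P] assms by auto
  let ?M = "pair_pmf (pmf_of_set ?P) (bernoulli_pmf p)"
  let ?E = "{(x, b). duplicate_point ?P x b = diagram (n + 1) \<rho>}"
  have pmf: "pmf (pmf_of_set ?P) x = 1 / real n" if "x \<in> ?P" for x
    using that fin by simp
  have "p_up p n \<sigma> \<rho> = measure_pmf.expectation ?M (indicator ?E)"
    by (simp add: p_up_def)
  also have "\<dots> = (\<Sum>z\<in>?P \<times> UNIV. indicator ?E z * pmf ?M z)"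
    by (rule integral_measure_pmf_real) (use fin in auto)
  also have "\<dots> = (\<Sum>x\<in>?P. \<Sum>b\<in>UNIV. (if b then p else 1 - p) *
      of_bool (duplicate_point ?P x b = diagram (n + 1) \<rho>) / real n)"
    unfolding sum.cartesian_product
    by (rule sum.cong[OF refl])
      (use assms in \<open>auto simp: pmf_pair pmf indicator_def\<close>)
  finally show ?thesis by (simp only: sum_divide_distrib)
qed

lemma p_up_p_down:
  assumes "0 < p" "p < 1" "n \<ge> 1" "\<sigma> \<in> perms n"
  shows "kernel_comp (perms (n + 1)) (p_up p n) (p_down (n + 1)) \<sigma> \<tau> =
    (\<Sum>x\<in>diagram n \<sigma>. \<Sum>b\<in>UNIV. (if b then p else 1 - p) *
      (\<Sum>q\<in>duplicate_point (diagram n \<sigma>) x b.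
        of_bool (delete_point (duplicate_point (diagram n \<sigma>) x b) q = diagram n \<tau>)))
    / (real n * (real n + 1))"
proof -
  let ?P = "diagram n \<sigma>" and ?w = "\<lambda>b. if b then p else 1 - p"
  have P: "?P \<in> diagrams n" using assms diagram_in_diagrams by blast
  \<comment> \<open>\<open>F\<close> is \<open>n + 1\<close> times the down-step probability of
    reaching \<open>\<tau>\<close>, taken as a function of the point set so that
    \<open>sum_perms_diagram\<close> applies.\<close>
  define F :: "(nat \<times> nat) set \<Rightarrow> real"
    where "F Q = (\<Sum>q\<in>Q. of_bool (delete_point Q q = diagram n \<tau>))" for Q
  have "kernel_comp (perms (n + 1)) (p_up p n) (p_down (n + 1)) \<sigma> \<tau> =
    (\<Sum>\<rho>\<in>perms (n + 1). (\<Sum>x\<in>?P. \<Sum>b\<in>UNIV. ?w b *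
      of_bool (duplicate_point ?P x b = diagram (n + 1) \<rho>)) / real n *
      (F (diagram (n + 1) \<rho>) / (real n + 1)))"
    unfolding kernel_comp_def
    by (rule sum.cong[OF refl], subst p_up_eq, (use assms in auto)[4], subst p_down_eq)
      (auto simp: F_def add.commute)
  also have "\<dots> = (\<Sum>\<rho>\<in>perms (n + 1). \<Sum>x\<in>?P. \<Sum>b\<in>UNIV. ?w b *
      (of_bool (duplicate_point ?P x b = diagram (n + 1) \<rho>) * F (diagram (n + 1) \<rho>)))
      / (real n * (real n + 1))"
    unfolding sum_divide_distrib sum_distrib_right by (simp add: mult.assoc sum_distrib_right)
  also have "(\<Sum>\<rho>\<in>perms (n + 1). \<Sum>x\<in>?P. \<Sum>b\<in>UNIV. ?w b *
      (of_bool (duplicate_point ?P x b = diagram (n + 1) \<rho>) * F (diagram (n + 1) \<rho>))) =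
    (\<Sum>x\<in>?P. \<Sum>b\<in>UNIV. ?w b * (\<Sum>\<rho>\<in>perms (n + 1).
      of_bool (duplicate_point ?P x b = diagram (n + 1) \<rho>) * F (diagram (n + 1) \<rho>)))"
    unfolding sum_distrib_left
    by (subst sum.swap, rule sum.cong[OF refl], rule sum.swap)
  also have "\<dots> = (\<Sum>x\<in>?P. \<Sum>b\<in>UNIV. ?w b * F (duplicate_point ?P x b))"
    by (intro sum.cong refl arg_cong2[where f = "(*)"] sum_perms_diagram duplicate_point_diagrams P)
  finally show ?thesis by (simp add: F_def)
qed

lemma p_down_p_up:
  assumes "0 < p" "p < 1" "n \<ge> 1" "\<sigma> \<in> perms (n + 1)"
  shows "kernel_comp (perms n) (p_down (n + 1)) (p_up p n) \<sigma> \<tau> =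
    (\<Sum>q\<in>diagram (n + 1) \<sigma>. \<Sum>x\<in>diagram (n + 1) \<sigma> - {q}. \<Sum>b\<in>UNIV. (if b then p else 1 - p) *
      of_bool (duplicate_point (delete_point (diagram (n + 1) \<sigma>) q) (down_point q x) b
        = diagram (n + 1) \<tau>))
    / (real n * (real n + 1))"
proof -
  let ?P = "diagram (n + 1) \<sigma>" and ?w = "\<lambda>b. if b then p else 1 - p"
  have P: "?P \<in> diagrams (n + 1)" using assms diagram_in_diagrams by blast
  define F :: "(nat \<times> nat) set \<Rightarrow> real"
    where "F Q = (\<Sum>x\<in>Q. \<Sum>b\<in>UNIV. ?w b * of_bool (duplicate_point Q x b = diagram (n + 1) \<tau>))" for Q
  have "kernel_comp (perms n) (p_down (n + 1)) (p_up p n) \<sigma> \<tau> =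
    (\<Sum>\<rho>\<in>perms n. (\<Sum>q\<in>?P. of_bool (delete_point ?P q = diagram n \<rho>)) / (real n + 1) *
      (F (diagram n \<rho>) / real n))"
    unfolding kernel_comp_def
    by (rule sum.cong[OF refl], subst p_down_eq, (use assms in auto)[2], subst p_up_eq)
      (use assms in \<open>auto simp: F_def add.commute\<close>)
  also have "\<dots> = (\<Sum>\<rho>\<in>perms n. \<Sum>q\<in>?P. of_bool (delete_point ?P q = diagram n \<rho>) * F (diagram n \<rho>))
      / (real n * (real n + 1))"
    unfolding sum_divide_distrib sum_distrib_right by (simp add: mult.commute)
  also have "(\<Sum>\<rho>\<in>perms n. \<Sum>q\<in>?P. of_bool (delete_point ?P q = diagram n \<rho>) * F (diagram n \<rho>)) =
      (\<Sum>q\<in>?P. \<Sum>\<rho>\<in>perms n. of_bool (delete_point ?P q = diagram n \<rho>) * F (diagram n \<rho>))"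
    by (rule sum.swap)
  also have "\<dots> = (\<Sum>q\<in>?P. F (delete_point ?P q))"
    by (intro sum.cong refl sum_perms_diagram delete_point_diagrams P)
  also have "\<dots> = (\<Sum>q\<in>?P. \<Sum>x\<in>?P - {q}. \<Sum>b\<in>UNIV. ?w b *
      of_bool (duplicate_point (delete_point ?P q) (down_point q x) b = diagram (n + 1) \<tau>))"
  proof (rule sum.cong[OF refl])
    fix q assume "q \<in> ?P"
    show "F (delete_point ?P q) = (\<Sum>x\<in>?P - {q}. \<Sum>b\<in>UNIV. ?w b *
      of_bool (duplicate_point (delete_point ?P q) (down_point q x) b = diagram (n + 1) \<tau>))"
      \<comment> \<open>The points of the smaller diagram are the \<open>down_point q x\<close> with
        \<open>x \<noteq> q\<close>. Only the index set is rewritten, so that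
        \<open>delete_point\<close> stays in the summand.\<close>
      unfolding F_def
      by (subst (1) delete_point_eq) (rule sum.reindex[OF inj_down_point[OF P \<open>q \<in> ?P\<close>], unfolded comp_def])
  qed
  finally show ?thesis by simp
qed

text \<open>The case \<open>n = 1\<close>, where the first coefficient is 0, is included because it
  starts the induction in \<open>T_eigenvalue_pos\<close>.\<close>

lemma kernel_identity:
  assumes p: "0 < p" "p < 1" and n: "n \<ge> 1" and \<sigma>: "\<sigma> \<in> perms n" and \<tau>: "\<tau> \<in> perms n"
  shows "kernel_comp (perms (n + 1)) (p_up p n) (p_down (n + 1)) \<sigma> \<tau> =
    (real n - 1) / (real n + 1) * kernel_comp (perms (n - 1)) (p_down n) (p_up p (n - 1)) \<sigma> \<tau>
    + 2 / (real n + 1) * id_kernel \<sigma> \<tau>"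
proof -
  let ?P = "diagram n \<sigma>" and ?w = "\<lambda>b. if b then p else 1 - p"
  have P: "?P \<in> diagrams n" using \<sigma> diagram_in_diagrams by blast
  have fin: "finite ?P" "card ?P = n"
    using diagrams_finite[OF P] diagrams_card[OF P] by auto
  have id: "of_bool (?P = diagram n \<tau>) = id_kernel \<sigma> \<tau>"
    using diagram_inj[of n] \<sigma> \<tau> by (auto simp: id_kernel_def dest: inj_onD)
  \<comment> \<open>The unnormalised kernel of a down-step followed by an up-step, as a sum over
    ordered pairs of distinct points; both sides are expressed through it.\<close>
  define S where "S = (\<Sum>q\<in>?P. \<Sum>x\<in>?P - {q}. \<Sum>b\<in>UNIV. ?w b *
      of_bool (duplicate_point (delete_point ?P q) (down_point q x) b = diagram n \<tau>))"
  have "(\<Sum>x\<in>?P. \<Sum>b\<in>UNIV. ?w b * (\<Sum>q\<in>duplicate_point ?P x b.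
        of_bool (delete_point (duplicate_point ?P x b) q = diagram n \<tau>))) =
     (\<Sum>x\<in>?P. \<Sum>b\<in>UNIV. ?w b * (2 * id_kernel \<sigma> \<tau> +
        (\<Sum>q\<in>?P - {x}. of_bool (duplicate_point (delete_point ?P q) (down_point q x) b = diagram n \<tau>))))"
    by (intro sum.cong refl arg_cong2[where f = "(*)"])
      (simp add: sum_duplicate_point[OF P, where f = "\<lambda>Q. of_bool (Q = diagram n \<tau>)"] id)
  also have "\<dots> = 2 * real n * id_kernel \<sigma> \<tau> + (\<Sum>x\<in>?P. \<Sum>b\<in>UNIV. ?w b *
        (\<Sum>q\<in>?P - {x}. of_bool (duplicate_point (delete_point ?P q) (down_point q x) b = diagram n \<tau>)))"
  proof -
    \<comment> \<open>The weights \<open>p\<close> and \<open>1 - p\<close> sum to 1, so the term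
      for the restored diagram passes through; summed over the \<open>n\<close> points it gives the
      factor \<open>2 * n\<close>.\<close>
    have "(\<Sum>b\<in>UNIV. ?w b * (K + G b)) = K + (\<Sum>b\<in>UNIV. ?w b * G b)" for K and G :: "bool \<Rightarrow> real"
      by (simp add: UNIV_bool algebra_simps)
    then show ?thesis using fin by (simp only: sum.distrib) simp
  qed
  also have "(\<Sum>x\<in>?P. \<Sum>b\<in>UNIV. ?w b *
        (\<Sum>q\<in>?P - {x}. of_bool (duplicate_point (delete_point ?P q) (down_point q x) b = diagram n \<tau>))) =
      (\<Sum>x\<in>?P. \<Sum>q\<in>?P - {x}. \<Sum>b\<in>UNIV. ?w b *
        of_bool (duplicate_point (delete_point ?P q) (down_point q x) b = diagram n \<tau>))"
    unfolding sum_distrib_left by (rule sum.cong[OF refl], rule sum.swap)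
  also have "\<dots> = S"
  proof -
    have "P - {z} = {y \<in> P. y \<noteq> z}" for P and z :: "nat \<times> nat" by auto
    then show ?thesis unfolding S_def
      using sum.swap_restrict[OF fin(1) fin(1), where R = "\<lambda>x q. q \<noteq> x"]
      by (simp add: eq_commute)
  qed
  finally have L: "kernel_comp (perms (n + 1)) (p_up p n) (p_down (n + 1)) \<sigma> \<tau> =
      (2 * real n * id_kernel \<sigma> \<tau> + S) / (real n * (real n + 1))"
    using p_up_p_down[OF p n \<sigma>] by simp
  \<comment> \<open>The factor \<open>n - 1\<close> reduces the normalisation
    \<open>n * (n - 1)\<close> to \<open>n\<close>. At \<open>n = 1\<close> both sides are 0, since
    a single point admits no pair.\<close>
  have R: "(real n - 1) * kernel_comp (perms (n - 1)) (p_down n) (p_up p (n - 1)) \<sigma> \<tau> = S / real n"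
  proof (cases "n = 1")
    case True
    then have *: "?P - {q} = {}" if "q \<in> ?P" for q
      using that fin by (metis card_1_singletonE Diff_cancel singletonD)
    have "S = 0" unfolding S_def by (rule sum.neutral, rule ballI) (simp only: * sum.empty)
    then show ?thesis using True by simp
  next
    case False
    then obtain m where "n = m + 1" "m \<ge> 1" using n by (intro that[of "n - 1"]) auto
    then show ?thesis using p_down_p_up[OF p, of m \<sigma> \<tau>] \<sigma> by (simp add: S_def)
  qed
  show ?thesis
    unfolding L times_divide_eq_left R using n by (simp add: add_divide_distrib)
qed

text \<open>Every deletion yields a diagram, so each of the \<open>n + 1\<close> points contributes
  exactly 1 to the row sum before normalisation.\<close>

lemma stochastic_p_down: "stochastic_matrix (perms (n + 1)) (perms n) (p_down (n + 1))"
  unfolding stochastic_matrix_def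
proof (intro ballI conjI)
  fix \<rho> assume \<rho>: "\<rho> \<in> perms (n + 1)"
  show "0 \<le> p_down (n + 1) \<rho> \<sigma>" for \<sigma> by (simp add: p_down_def)
  let ?P = "diagram (n + 1) \<rho>"
  have P: "?P \<in> diagrams (n + 1)" using \<rho> diagram_in_diagrams by blast
  have "(\<Sum>\<sigma>\<in>perms n. p_down (n + 1) \<rho> \<sigma>) =
      (\<Sum>\<sigma>\<in>perms n. \<Sum>q\<in>?P. of_bool (delete_point ?P q = diagram n \<sigma>)) / (real n + 1)"
    using \<rho> by (simp add: p_down_eq sum_divide_distrib add.commute)
  also have "(\<Sum>\<sigma>\<in>perms n. \<Sum>q\<in>?P. of_bool (delete_point ?P q = diagram n \<sigma>)) =
      (\<Sum>q\<in>?P. \<Sum>\<sigma>\<in>perms n. of_bool (delete_point ?P q = diagram n \<sigma>) * (1 :: real))"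
    by (subst sum.swap) simp
  also have "\<dots> = (\<Sum>q\<in>?P. 1)"
    by (intro sum.cong refl sum_perms_diagram delete_point_diagrams P)
  finally show "(\<Sum>\<sigma>\<in>perms n. p_down (n + 1) \<rho> \<sigma>) = 1"
    using diagrams_card[OF P] by simp
qed

section \<open>Transition operators\<close>

lemma transition_op_comp:
  "transition_op X Y \<mu> (transition_op Y Z \<nu> f) = transition_op X Z (kernel_comp Y \<mu> \<nu>) f"
proof -
  have "(\<Sum>y\<in>Y. \<mu> x y * (\<Sum>z\<in>Z. \<nu> y z * f z)) = (\<Sum>z\<in>Z. (\<Sum>y\<in>Y. \<mu> x y * \<nu> y z) * f z)" for x
    unfolding sum_distrib_left sum_distrib_right mult.assoc[symmetric] by (rule sum.swap)
  then show ?thesis by (simp add: transition_op_def kernel_comp_def cong: sum.cong restrict_cong)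
qed

lemma transition_op_linear:
  "transition_op X Y \<mu> (\<lambda>y\<in>Y. a * f y + b * g y) =
    (\<lambda>x\<in>X. a * transition_op X Y \<mu> f x + b * transition_op X Y \<mu> g x)"
  by (auto simp: transition_op_def fun_eq_iff algebra_simps sum.distrib sum_distrib_left)

lemma C_eqI: "\<lbrakk>f \<in> C X; g \<in> C X; \<And>x. x \<in> X \<Longrightarrow> f x = g x\<rbrakk> \<Longrightarrow> f = g"
  unfolding C_def by (rule PiE_ext)

section \<open>The up-step operator, the two factorisations and the spectrum\<close>

definition U :: "real \<Rightarrow> nat \<Rightarrow> ((nat \<Rightarrow> nat) \<Rightarrow> real) \<Rightarrow> ((nat \<Rightarrow> nat) \<Rightarrow> real)" where
  "U p n = transition_op (perms n) (perms (n + 1)) (p_up p n)"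

text \<open>Agreement is asked only on \<open>perms (n + 1)\<close>, which is all that
  \<open>U\<close> sees, so eigenvalue equations proved only there can be transported.\<close>

lemma U_scale:
  "\<lbrakk>\<And>\<rho>. \<rho> \<in> perms (n + 1) \<Longrightarrow> g \<rho> = a * f \<rho>; \<sigma> \<in> perms n\<rbrakk> \<Longrightarrow> U p n g \<sigma> = a * U p n f \<sigma>"
  by (simp add: U_def transition_op_def sum_distrib_left mult.left_commute cong: sum.cong)

lemma T_eq_U_D: "T p n f = U p n (D (n + 1) f)"
  by (simp add: T_def U_def D_def transition_op_comp)

lemma T_eq_D_U:
  assumes "0 < p" "p < 1" "n \<ge> 1" "\<sigma> \<in> perms n"
  shows "T p n f \<sigma> =
    (real n - 1) / (real n + 1) * D n (U p (n - 1) f) \<sigma> + 2 / (real n + 1) * f \<sigma>"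
proof -
  let ?K = "kernel_comp (perms (n - 1)) (p_down n) (p_up p (n - 1))"
  have "T p n f \<sigma> = (\<Sum>\<tau>\<in>perms n.
      ((real n - 1) / (real n + 1) * ?K \<sigma> \<tau> + 2 / (real n + 1) * id_kernel \<sigma> \<tau>) * f \<tau>)"
    unfolding T_def transition_op_def using kernel_identity[OF assms] assms(4)
    by (simp cong: sum.cong)
  also have "\<dots> = (real n - 1) / (real n + 1) * (\<Sum>\<tau>\<in>perms n. ?K \<sigma> \<tau> * f \<tau>)
      + 2 / (real n + 1) * (\<Sum>\<tau>\<in>perms n. id_kernel \<sigma> \<tau> * f \<tau>)"
    unfolding distrib_right sum.distrib sum_distrib_left by (simp only: mult.assoc)
  also have "(\<Sum>\<tau>\<in>perms n. id_kernel \<sigma> \<tau> * f \<tau>) = f \<sigma>"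
    using assms(4) finite_perms by (simp add: id_kernel_def if_distrib[of "\<lambda>x. x * _"] cong: if_cong)
  also have "(\<Sum>\<tau>\<in>perms n. ?K \<sigma> \<tau> * f \<tau>) = D n (U p (n - 1) f) \<sigma>"
    using assms(3,4) by (simp add: D_def U_def transition_op_comp) (simp add: transition_op_def)
  finally show ?thesis .
qed

text \<open>All \<open>l \<le> 0\<close> are treated at once because the induction changes the
  eigenvalue. If \<open>D U f = l' f\<close>, then \<open>T (U f) = U D U f = l' (U f)\<close>, so
  \<open>U f = 0\<close> by induction and hence \<open>l' f = 0\<close>.\<close>

lemma T_eigenvalue_pos:
  assumes p: "0 < p" "p < 1" and "n \<ge> 1" and "l \<le> 0"
    and "\<And>\<sigma>. \<sigma> \<in> perms n \<Longrightarrow> T p n f \<sigma> = l * f \<sigma>" and "\<sigma> \<in> perms n"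
  shows "f \<sigma> = 0"
  using assms(3-)
proof (induction n arbitrary: l f \<sigma> rule: nat_induct_at_least)
  case base
  \<comment> \<open>At size 1 the two coefficients of \<open>T_eq_D_U\<close> are 0 and 1, so
    \<open>T\<close> is the identity.\<close>
  then have "f \<sigma> = l * f \<sigma>" using T_eq_D_U[OF p, of 1 \<sigma> f] by simp
  then have "(1 - l) * f \<sigma> = 0" by (simp add: algebra_simps)
  then show ?case using \<open>l \<le> 0\<close> by simp
next
  case (Suc n)
  \<comment> \<open>\<open>l'\<close> solves \<open>l = n / (n + 2) * l' + 2 / (n + 2)\<close>, the
    eigenvalue relation that \<open>T_eq_D_U\<close> gives at size \<open>n + 1\<close>.\<close>
  define l' where "l' = (l - 2 / (real n + 2)) / (real n / (real n + 2))"
  have neg: "l' < 0" unfolding l'_def using Suc.prems(1) Suc.hyps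
    by (intro divide_neg_pos) (auto intro: le_less_trans[of _ 0])
  have DU: "D (n + 1) (U p n f) \<tau> = l' * f \<tau>" if "\<tau> \<in> perms (n + 1)" for \<tau>
  proof -
    have "T p (n + 1) f \<tau> = real n / (real n + 2) * D (n + 1) (U p n f) \<tau> + 2 / (real n + 2) * f \<tau>"
      using T_eq_D_U[OF p, of "n + 1" \<tau> f] that by (simp add: add.commute)
    then have "real n / (real n + 2) * D (n + 1) (U p n f) \<tau> = (l - 2 / (real n + 2)) * f \<tau>"
      using Suc.prems(2)[of \<tau>] that by (simp add: algebra_simps)
    moreover have "real n / (real n + 2) \<noteq> 0" using Suc.hyps by simp
    ultimately show ?thesis unfolding l'_def by (metis nonzero_mult_div_cancel_left times_divide_eq_left)
  qed
  have "U p n f \<tau> = 0" if "\<tau> \<in> perms n" for \<tau>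
  proof (rule Suc.IH[of l' "U p n f" \<tau>])
    fix \<upsilon> assume "\<upsilon> \<in> perms n"
    then show "T p n (U p n f) \<upsilon> = l' * U p n f \<upsilon>"
      unfolding T_eq_U_D using DU by (rule U_scale[rotated])
  qed (use neg that in auto)
  then have "D (n + 1) (U p n f) \<sigma> = 0"
    using Suc.prems(3) by (simp add: D_def transition_op_def)
  \<comment> \<open>\<open>l'\<close> is strictly negative even when \<open>l = 0\<close>, so it can
    be cancelled.\<close>
  then show ?case using DU[of \<sigma>] Suc.prems(3) neg by simp
qed

text \<open>The shape fits three uses: \<open>a = c n\<close> for \<open>A p n\<close>,
  \<open>a = 1\<close> for the difference in \<open>D_inj\<close>, and \<open>g = 0\<close> for the
  preimage in the range inclusion.\<close>

lemma D_scale_diff: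
  assumes "\<rho> \<in> perms (n + 1)"
  shows "D (n + 1) (\<lambda>\<sigma>\<in>perms n. a * (f \<sigma> - g \<sigma>)) \<rho> = a * (D (n + 1) f \<rho> - D (n + 1) g \<rho>)"
  using assms transition_op_linear[of "perms (n + 1)" "perms n" "p_down (n + 1)" a f "- a" g]
  by (simp add: D_def algebra_simps)

text \<open>\<open>D\<close> does not involve \<open>p\<close>, which enters through
  \<open>T = U D\<close>: a function killed by \<open>D\<close> satisfies the eigenvalue equation of
  \<open>T\<close> for 0, hence vanishes.\<close>

lemma D_inj:
  assumes p: "0 < (p :: real)" "p < 1" and "n \<ge> 1"
  shows "inj_on (D (n + 1)) (C (perms n))"
proof (rule inj_onI)
  fix f g assume fg: "f \<in> C (perms n)" "g \<in> C (perms n)" "D (n + 1) f = D (n + 1) g"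
  define h where "h = (\<lambda>\<sigma>\<in>perms n. 1 * (f \<sigma> - g \<sigma>))"
  have "D (n + 1) h \<rho> = 0" if "\<rho> \<in> perms (n + 1)" for \<rho>
    unfolding h_def D_scale_diff[OF that] fg(3) by simp
  then have "T p n h \<sigma> = 0 * h \<sigma>" if "\<sigma> \<in> perms n" for \<sigma>
    using that by (simp add: T_eq_U_D U_def transition_op_def)
  then have "h \<sigma> = 0" if "\<sigma> \<in> perms n" for \<sigma>
    using T_eigenvalue_pos[OF assms, of 0 h \<sigma>] that by simp
  then have "f \<sigma> = g \<sigma>" if "\<sigma> \<in> perms n" for \<sigma>
    using that by (simp add: h_def)
  then show "f = g" by (rule C_eqI[OF fg(1,2)])
qed

text \<open>The choice of \<open>c\<close> matters here:
  \<open>1 - 2 / (n + 2) = n / (n + 2)\<close> and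
  \<open>c (n + 1) * n / (n + 2) = c n\<close>.\<close>

lemma A_Suc:
  assumes "0 < p" "p < 1" "\<rho> \<in> perms (n + 1)"
  shows "A p (n + 1) f \<rho> = c n * (D (n + 1) (U p n f) \<rho> - f \<rho>)"
proof -
  have "(real n + 2) * T p (n + 1) f \<rho> = real n * D (n + 1) (U p n f) \<rho> + 2 * f \<rho>"
    using T_eq_D_U[OF assms(1,2), of "n + 1" \<rho> f] assms(3)
    by (simp add: add_divide_distrib[symmetric] add.commute)
  then have "(real n + 2) * (T p (n + 1) f \<rho> - f \<rho>) = real n * (D (n + 1) (U p n f) \<rho> - f \<rho>)"
    by (simp add: algebra_simps)
  then show ?thesis using assms(3) by (simp add: A_def c_def mult_ac add.commute)
qed

theorem proposition6p1:
  fixes p :: real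
  assumes "0 < p" and "p < 1"
  shows "(\<forall>n\<ge>2. \<forall>\<sigma>\<in>perms n. \<forall>\<tau>\<in>perms n.
            kernel_comp (perms (n + 1)) (p_up p n) (p_down (n + 1)) \<sigma> \<tau> =
              (real n - 1) / (real n + 1)
                * kernel_comp (perms (n - 1)) (p_down n) (p_up p (n - 1)) \<sigma> \<tau>
              + 2 / (real n + 1) * id_kernel \<sigma> \<tau>) \<and>
         (\<forall>n\<ge>1.
            0 < c n \<and> c n < c (n + 1) \<and>
            is_transition_op (perms n) (perms (n + 1)) (D (n + 1)) \<and>
            (\<lambda>f. \<lambda>\<sigma>\<in>perms (n + 1). A p (n + 1) f \<sigma> + c n * f \<sigma>) ` C (perms (n + 1))
              \<subseteq> D (n + 1) ` C (perms n) \<and>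
            inj_on (D (n + 1)) (C (perms n)) \<and>
            (\<forall>f\<in>C (perms n). A p (n + 1) (D (n + 1) f) = D (n + 1) (A p n f)))"
proof (intro conjI allI impI ballI)
  fix n :: nat and \<sigma> \<tau> assume "2 \<le> n" "\<sigma> \<in> perms n" "\<tau> \<in> perms n"
  then show "kernel_comp (perms (n + 1)) (p_up p n) (p_down (n + 1)) \<sigma> \<tau> =
      (real n - 1) / (real n + 1) * kernel_comp (perms (n - 1)) (p_down n) (p_up p (n - 1)) \<sigma> \<tau>
      + 2 / (real n + 1) * id_kernel \<sigma> \<tau>"
    by (intro kernel_identity assms) auto
next
  fix n :: nat assume n: "1 \<le> n"
  show "0 < c n" using n by (simp add: c_def)
  show "c n < c (n + 1)" by (simp add: c_def algebra_simps)
  show "is_transition_op (perms n) (perms (n + 1)) (D (n + 1))"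
    unfolding is_transition_op_def using stochastic_p_down by (auto simp: D_def)
  show "inj_on (D (n + 1)) (C (perms n))" using D_inj[OF assms n] .
  show "(\<lambda>f. \<lambda>\<sigma>\<in>perms (n + 1). A p (n + 1) f \<sigma> + c n * f \<sigma>) ` C (perms (n + 1))
      \<subseteq> D (n + 1) ` C (perms n)"
  proof (rule image_subsetI)
    fix f
    \<comment> \<open>By \<open>A_Suc\<close> the function to be reached is
      \<open>c n * D (U f)\<close>, so the preimage is \<open>c n * U f\<close>; the
      \<open>- 0\<close> gives it the shape of \<open>D_scale_diff\<close>.\<close>
    define g where "g = (\<lambda>\<sigma>\<in>perms n. c n * (U p n f \<sigma> - 0))"
    have "(\<lambda>\<sigma>\<in>perms (n + 1). A p (n + 1) f \<sigma> + c n * f \<sigma>) = D (n + 1) g"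
    proof (rule C_eqI[of _ "perms (n + 1)"])
      fix \<rho> assume \<rho>: "\<rho> \<in> perms (n + 1)"
      have "D (n + 1) (\<lambda>_. 0) \<rho> = 0" using \<rho> by (simp add: D_def transition_op_def)
      then have "D (n + 1) g \<rho> = c n * D (n + 1) (U p n f) \<rho>"
        unfolding g_def D_scale_diff[OF \<rho>, of "c n" _ "\<lambda>_. 0"] by simp
      then show "(\<lambda>\<sigma>\<in>perms (n + 1). A p (n + 1) f \<sigma> + c n * f \<sigma>) \<rho> = D (n + 1) g \<rho>"
        using A_Suc[OF assms \<rho>, of f] \<rho> by (simp add: algebra_simps)
    qed (simp_all add: C_def D_def transition_op_def)
    moreover have "g \<in> C (perms n)" by (simp add: g_def C_def)
    ultimately show "(\<lambda>\<sigma>\<in>perms (n + 1). A p (n + 1) f \<sigma> + c n * f \<sigma>) \<in> D (n + 1) ` C (perms n)"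
      by blast
  qed
  fix f
  show "A p (n + 1) (D (n + 1) f) = D (n + 1) (A p n f)"
  proof (rule C_eqI[of _ "perms (n + 1)"])
    fix \<rho> assume \<rho>: "\<rho> \<in> perms (n + 1)"
    \<comment> \<open>With \<open>T = U D\<close>, applying \<open>D\<close> gives
      \<open>c n * (D U D f - D f)\<close>, which is \<open>A_Suc\<close> at
      \<open>D f\<close>.\<close>
    have "A p n f = (\<lambda>\<sigma>\<in>perms n. c n * (U p n (D (n + 1) f) \<sigma> - f \<sigma>))"
      unfolding A_def T_eq_U_D ..
    then show "A p (n + 1) (D (n + 1) f) \<rho> = D (n + 1) (A p n f) \<rho>"
      using A_Suc[OF assms \<rho>] D_scale_diff[OF \<rho>] by simp
  qed (simp_all add: C_def A_def D_def transition_op_def)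
qed

end
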